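(* Let $\mathcal G=\{\mathcal V,\mathcal E\}$ be a simple bi-directed graph on $\mathcal V=\{1,\dots,m\}$ with a clustering $\mathcal C=\{\mathcal C_1,\dots,\mathcal C_K\}$, let $L=[l_{ij}]_{i,j=1}^m$ be the associated weighted Laplacian (defined in the context), let $f_1,\dots,f_K:\mathbb R^n\to\mathbb R^n$ be continuous, $\Gamma\in\mathbb R^{n\times n}$ and $c>0$, and consider the coupled system $$\dot x^i=f_k(x^i)+c\sum_{j=1}^m l_{ij}\Gamma x^j,\qquad i\in\mathcal C_k,\ k=1,\dots,K.$$ Suppose that the common inter-cluster coupling condition holds, that $\Gamma$ is symmetric and nonnegative definite, and that, for some $\alpha\in\mathbb R$, each function $f_k(\cdot)-\alpha\Gamma\,\cdot$ $(k=1,\dots,K)$ satisfies the decreasing condition. If there exists a positive definite diagonal matrix $D=\mathrm{diag}[d_1,\dots,d_m]$, with $d=[d_1,\dots,d_m]^\top$, such that $$\big[D(cL+\alpha I_m)\big]^{s}\big|_{\mathcal T^{d}_{\mathcal C}(1)}\le 0,$$ then the coupled system cluster synchronizes with respect to the clustering $\mathcal C$, i.e. for every solution, $\lim_{t\to\infty}[x^i(t)-x^j(t)]=0$ for all $i,j\in\mathcal C_k$ and all $k=1,\dots,K$.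
   Context: Graph and clustering: "simple" means no self-loops or multiple edges; "bi-directed" means $e(i,j)\in\mathcal E$ if and only if $e(j,i)\in\mathcal E$. $\mathcal N(i)=\{j\in\mathcal V: e(i,j)\in\mathcal E\}$ is the neighborhood of $i$. A clustering is a partition of $\mathcal V$: $\bigcup_{k=1}^K\mathcal C_k=\mathcal V$ and $\mathcal C_k\cap\mathcal C_l=\emptyset$ for $k\neq l$. Put $\mathcal N_{k}(i)=\mathcal N(i)\cap\mathcal C_{k}$ and $d_{i,k}=\#\mathcal N_k(i)$. Weighted Laplacian $L$: for $i\ne j$, $l_{ij}=1/d_{i,k}$ if $j\in\mathcal N_k(i)$ for some $k\in\{1,\dots,K\}$ (this $k$ is the index of the cluster containing $j$), and $l_{ij}=0$ otherwise; $l_{ii}=-\sum_{j\ne i}l_{ij}$. Common inter-cluster coupling condition: for $i\in\mathcal C_k$ let $\mathcal L_k^i=\{k': k'\ne k,\ \mathcal N_{k'}(i)\neq\emptyset\}$. The condition is that for every $k=1,\dots,K$, $\mathcal L_k^i=\mathcal L_k^{i'}$ for all $i,i'\in\mathcal C_k$. Decreasing condition for $f_k(\cdot)-\alpha\Gamma\,\cdot$: there exists $\delta>0$ such that $(\xi-\zeta)^\top[f_k(\xi)-f_k(\zeta)-\alpha\Gamma(\xi-\zeta)]\le-\delta(\xi-\zeta)^\top(\xi-\zeta)$ for all $\xi,\zeta\in\mathbb R^n$. Transverse space: $\mathcal T^d_{\mathcal C}(1)=\{u=[u^1,\dots,u^m]^\top\in\mathbb R^m:\ \sum_{i\in\mathcal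 C_k}d_iu^i=0\ \text{for all }k=1,\dots,K\}$. Matrix notation: $Z^s=(Z+Z^\top)/2$, $I_m$ is the identity matrix, and $Z|_V\le 0$ means $u^\top Zu\le 0$ for all $u$ in the linear subspace $V$. Standing assumptions: solutions of the coupled system exist for all $t\ge0$ and are bounded. The $x^i(t)\in\mathbb R^n$ are the vertex states. The functions $f_k$ of different clusters are assumed so different that trajectories in different clusters do not approach each other; under this assumption cluster synchronization means the convergence stated in the claim. *)

theory Defs
  imports "HOL-Analysis.Analysis"
begin

text \<open>
  The vertex set is the universe of the finite type \<open>'m\<close>, and the edge set is a relation on it;
  a simple bi-directed graph is an irreflexive and symmetric one.
  Clusters are indexed by \<open>{1..K}\<close>; values of \<open>C\<close> and \<open>f\<close> outside this range are irrelevant.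
\<close>

definition is_clustering :: "nat \<Rightarrow> (nat \<Rightarrow> 'm set) \<Rightarrow> bool" where
  "is_clustering K C \<longleftrightarrow> (\<Union>k\<in>{1..K}. C k) = UNIV \<and> disjoint_family_on C {1..K}"

definition nbhd :: "('m \<times> 'm) set \<Rightarrow> 'm \<Rightarrow> 'm set" where
  "nbhd E i = {j. (i, j) \<in> E}"

definition cluster_nbhd :: "('m \<times> 'm) set \<Rightarrow> (nat \<Rightarrow> 'm set) \<Rightarrow> nat \<Rightarrow> 'm \<Rightarrow> 'm set" where
  "cluster_nbhd E C k i = nbhd E i \<inter> C k"

text \<open>The index below is unique whenever \<open>C\<close> is a clustering.\<close>

definition coupling_weight ::
    "('m \<times> 'm) set \<Rightarrow> nat \<Rightarrow> (nat \<Rightarrow> 'm set) \<Rightarrow> 'm \<Rightarrow> 'm \<Rightarrow> real" where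
  "coupling_weight E K C i j =
     (if \<exists>k\<in>{1..K}. j \<in> cluster_nbhd E C k i
      then 1 / real (card (cluster_nbhd E C (THE k. k \<in> {1..K} \<and> j \<in> cluster_nbhd E C k i) i))
      else 0)"

definition weighted_laplacian ::
    "('m::finite \<times> 'm) set \<Rightarrow> nat \<Rightarrow> (nat \<Rightarrow> 'm set) \<Rightarrow> real ^ 'm ^ 'm" where
  "weighted_laplacian E K C =
     (\<chi> i j. if i = j then - (\<Sum>j'\<in>UNIV - {i}. coupling_weight E K C i j')
            else coupling_weight E K C i j)"

definition linked_clusters ::
    "('m \<times> 'm) set \<Rightarrow> nat \<Rightarrow> (nat \<Rightarrow> 'm set) \<Rightarrow> nat \<Rightarrow> 'm \<Rightarrow> nat set" where
  "linked_clusters E K C k i = {k' \<in> {1..K}. k' \<noteq> k \<and> cluster_nbhd E C k' i \<noteq> {}}"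

definition common_intercluster_coupling ::
    "('m \<times> 'm) set \<Rightarrow> nat \<Rightarrow> (nat \<Rightarrow> 'm set) \<Rightarrow> bool" where
  "common_intercluster_coupling E K C \<longleftrightarrow>
     (\<forall>k\<in>{1..K}. \<forall>i\<in>C k. \<forall>i'\<in>C k. linked_clusters E K C k i = linked_clusters E K C k i')"

definition decreasing_condition :: "(real ^ 'n \<Rightarrow> real ^ 'n) \<Rightarrow> real \<Rightarrow> real ^ 'n ^ 'n \<Rightarrow> bool" where
  "decreasing_condition f \<alpha> \<Gamma> \<longleftrightarrow>
     (\<exists>\<delta>>0. \<forall>\<xi> \<zeta>. (\<xi> - \<zeta>) \<bullet> (f \<xi> - f \<zeta> - \<alpha> *\<^sub>R (\<Gamma> *v (\<xi> - \<zeta>)))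
                     \<le> - \<delta> * ((\<xi> - \<zeta>) \<bullet> (\<xi> - \<zeta>)))"

definition transverse_space :: "nat \<Rightarrow> (nat \<Rightarrow> 'm set) \<Rightarrow> real ^ 'm \<Rightarrow> (real ^ 'm) set" where
  "transverse_space K C d = {u. \<forall>k\<in>{1..K}. (\<Sum>i\<in>C k. d $ i * u $ i) = 0}"

definition diag_mat :: "real ^ 'm \<Rightarrow> real ^ 'm ^ 'm" where
  "diag_mat d = (\<chi> i j. if i = j then d $ i else 0)"

definition sym_part :: "real ^ 'm ^ 'm \<Rightarrow> real ^ 'm ^ 'm" where
  "sym_part Z = (1 / 2) *\<^sub>R (Z + transpose Z)"

definition positive_definite :: "real ^ 'm ^ 'm \<Rightarrow> bool" where
  "positive_definite Z \<longleftrightarrow> (\<forall>u. u \<noteq> 0 \<longrightarrow> 0 < u \<bullet> (Z *v u))"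

definition nonneg_definite :: "real ^ 'm ^ 'm \<Rightarrow> bool" where
  "nonneg_definite Z \<longleftrightarrow> (\<forall>u. 0 \<le> u \<bullet> (Z *v u))"

definition nonpos_on :: "real ^ 'm ^ 'm \<Rightarrow> (real ^ 'm) set \<Rightarrow> bool" where
  "nonpos_on Z V \<longleftrightarrow> (\<forall>u\<in>V. u \<bullet> (Z *v u) \<le> 0)"

text \<open>Solutions live on \<open>[0,\<infinity>)\<close>; the derivative at time \<open>0\<close> is the right-hand one.\<close>

definition coupled_solution ::
    "('m::finite \<times> 'm) set \<Rightarrow> nat \<Rightarrow> (nat \<Rightarrow> 'm set) \<Rightarrow> (nat \<Rightarrow> real ^ 'n \<Rightarrow> real ^ 'n) \<Rightarrow>
     real ^ 'n ^ 'n \<Rightarrow> real \<Rightarrow> (real \<Rightarrow> real ^ 'n ^ 'm) \<Rightarrow> bool" where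
  "coupled_solution E K C f \<Gamma> c x \<longleftrightarrow>
     (\<forall>t\<ge>0. \<forall>k\<in>{1..K}. \<forall>i\<in>C k.
        ((\<lambda>s. x s $ i) has_vector_derivative
           f k (x t $ i) + c *\<^sub>R (\<Sum>j\<in>UNIV. weighted_laplacian E K C $ i $ j *\<^sub>R (\<Gamma> *v (x t $ j))))
        (at t within {0..}))"

definition solutions_global_and_bounded ::
    "('m::finite \<times> 'm) set \<Rightarrow> nat \<Rightarrow> (nat \<Rightarrow> 'm set) \<Rightarrow> (nat \<Rightarrow> real ^ 'n \<Rightarrow> real ^ 'n) \<Rightarrow>
     real ^ 'n ^ 'n \<Rightarrow> real \<Rightarrow> bool" where
  "solutions_global_and_bounded E K C f \<Gamma> c \<longleftrightarrow>
     (\<forall>x0. \<exists>x. coupled_solution E K C f \<Gamma> c x \<and> x 0 = x0) \<and>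
     (\<forall>x. coupled_solution E K C f \<Gamma> c x \<longrightarrow> bounded (x ` {0..}))"

definition cluster_synchronizes ::
    "('m::finite \<times> 'm) set \<Rightarrow> nat \<Rightarrow> (nat \<Rightarrow> 'm set) \<Rightarrow> (nat \<Rightarrow> real ^ 'n \<Rightarrow> real ^ 'n) \<Rightarrow>
     real ^ 'n ^ 'n \<Rightarrow> real \<Rightarrow> bool" where
  "cluster_synchronizes E K C f \<Gamma> c \<longleftrightarrow>
     (\<forall>x. coupled_solution E K C f \<Gamma> c x \<longrightarrow>
        (\<forall>k\<in>{1..K}. \<forall>i\<in>C k. \<forall>j\<in>C k. ((\<lambda>t. x t $ i - x t $ j) \<longlongrightarrow> 0) at_top))"

end

theory Submission
  imports Defs
begin

text \<open>
  The proof is a Lyapunov argument. Write \<open>y\<^sub>i\<close> for the deviation of \<open>x\<^sub>i\<close> from the mean of its own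
  cluster, taken with the weights \<open>d\<close>. By the choice of these weights, the family \<open>y\<close> is
  \<open>d\<close>-orthogonal to every family that is constant on clusters, so along a solution the energy
  \<open>V = (\<Sum>i. d\<^sub>i * (y\<^sub>i \<bullet> y\<^sub>i))\<close> satisfies \<open>V' = 2 * (\<Sum>i. d\<^sub>i * (y\<^sub>i \<bullet> x'\<^sub>i))\<close>, and any part of \<open>x'\<^sub>i\<close> that
  depends only on the cluster of \<open>i\<close> may be dropped or added.

  Two such parts matter. The common inter-cluster coupling condition makes the row sums of the
  Laplacian over each cluster agree for all vertices of one cluster (\<open>laplacian_cluster_row_sum\<close>);
  hence the cluster means drop out of the coupling term
  and \<open>x\<close> may be replaced by \<open>y\<close> there. Likewise \<open>f\<^sub>k\<close> evaluated at the cluster mean may be subtracted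
  from \<open>f\<^sub>k x\<^sub>i\<close>, and the decreasing condition bounds the inner product of \<open>y\<^sub>i\<close> with the resulting
  difference, less \<open>\<alpha> \<Gamma> y\<^sub>i\<close>, by \<open>- \<delta> * (y\<^sub>i \<bullet> y\<^sub>i)\<close>. What remains is the quadratic form of \<open>D (c L + \<alpha> I)\<close> tensored with \<open>\<Gamma>\<close>,
  evaluated at \<open>y\<close>. As \<open>\<Gamma>\<close> is a sum of rank-one forms \<open>w w\<^sup>T\<close> (\<open>psd_sum_of_rank_one\<close>), it is a sum of
  values of the form of \<open>D (c L + \<alpha> I)\<close> at the scalar families \<open>w \<bullet> y\<^sub>i\<close>, all of which lie in the
  transverse space; so it is nonpositive (\<open>tensor_nonpos\<close>).

  Altogether \<open>V' \<le> - 2 * \<delta> * V\<close> (\<open>energy_dissipation\<close>), so \<open>V\<close> decays exponentially and the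
  deviations tend to zero.
\<close>

section \<open>Nonnegative forms and their tensor products\<close>

text \<open>
  Splitting off one rank-one term is completing the square: if \<open>v \<bullet> g v > 0\<close>, subtracting the
  rank-one form of \<open>g v / sqrt (v \<bullet> g v)\<close> from \<open>g\<close> leaves a nonnegative form. Its kernel contains that
  of \<open>g\<close> and, in addition, \<open>v\<close>; so the induction is on the codimension of the kernel.
\<close>

lemma psd_sum_of_rank_one:
  fixes g :: "'a::euclidean_space \<Rightarrow> 'a"
  assumes "linear g"
    and "\<And>u v. u \<bullet> g v = g u \<bullet> v"
    and "\<And>v. 0 \<le> v \<bullet> g v"
  shows "\<exists>(N::nat) w. \<forall>v. g v = (\<Sum>p<N. (w p \<bullet> v) *\<^sub>R w p)"
  using assms
proof (induction "DIM('a) - dim {v. g v = 0}" arbitrary: g rule: less_induct)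
  case less
  note lin = less.prems(1) and self_adjoint = less.prems(2) and psd = less.prems(3)
  show ?case
  proof (cases "\<forall>v. v \<bullet> g v = 0")
    case True
    have "u \<bullet> g v = 0" for u v
    proof -
      have "(u + v) \<bullet> g (u + v) = u \<bullet> g u + v \<bullet> g v + 2 * (u \<bullet> g v)"
        using self_adjoint[of v u]
        by (simp add: linear_add[OF lin] inner_add_left inner_add_right inner_commute)
      then show ?thesis using True by simp
    qed
    then have "g v = 0" for v
      by (metis inner_eq_zero_iff)
    then show ?thesis
      by (intro exI[of _ 0]) simp
  next
    case False
    then obtain v where v: "v \<bullet> g v > 0"
      using psd by (metis order_le_less)
    define w where "w = (1 / sqrt (v \<bullet> g v)) *\<^sub>R g v"
    define h where "h u = g u - (w \<bullet> u) *\<^sub>R w" for u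
    have w_scale: "(w \<bullet> u) *\<^sub>R w = ((g v \<bullet> u) / (v \<bullet> g v)) *\<^sub>R g v" for u
      using v by (simp add: w_def)
    have lin_h: "linear h"
      unfolding h_def
      by (intro linear_compose_sub lin linear_compose_scale_right linearI)
        (auto simp: inner_add_right scaleR_add_left)
    have h_self_adjoint: "a \<bullet> h b = h a \<bullet> b" for a b
      using self_adjoint[of a b] by (simp add: h_def inner_diff_left inner_diff_right inner_commute)
    have h_psd: "0 \<le> u \<bullet> h u" for u
    proof -
      define s where "s = (g v \<bullet> u) / (v \<bullet> g v)"
      have sv: "s * (v \<bullet> g v) = g v \<bullet> u"
        using v by (simp add: s_def)
      have "(u - s *\<^sub>R v) \<bullet> g (u - s *\<^sub>R v)
          = u \<bullet> g u - s * (u \<bullet> g v) - s * (v \<bullet> g u) + s * (s * (v \<bullet> g v))"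
        by (simp add: linear_diff[OF lin] linear_scale[OF lin] inner_diff_left inner_diff_right
            algebra_simps)
      also have "\<dots> = u \<bullet> g u - s * (g v \<bullet> u)"
        using self_adjoint[of v u] by (simp add: sv inner_commute)
      also have "\<dots> = u \<bullet> h u"
        unfolding h_def w_scale by (simp add: s_def inner_diff_right inner_commute)
      finally show ?thesis
        using psd[of "u - s *\<^sub>R v"] by simp
    qed
    have "{u. g u = 0} \<subset> {u. h u = 0}"
    proof
      have "h u = 0" if "g u = 0" for u
        using that self_adjoint[of v u] by (simp add: h_def w_scale)
      then show "{u. g u = 0} \<subseteq> {u. h u = 0}" by auto
      have "h v = 0"
        using v unfolding h_def w_scale by (simp add: inner_commute)
      moreover have "g v \<noteq> 0"
        using v by auto
      ultimately show "{u. g u = 0} \<noteq> {u. h u = 0}" by auto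
    qed
    moreover have "subspace {u. g u = 0}" "subspace {u. h u = 0}"
      using lin lin_h by (auto intro: linear_subspace_kernel)
    ultimately have "dim {u. g u = 0} < dim {u. h u = 0}"
      by (metis dim_psubset span_eq_iff)
    then have "DIM('a) - dim {u. h u = 0} < DIM('a) - dim {u. g u = 0}"
      using dim_subset_UNIV[of "{u. h u = 0}"] by linarith
    from less.hyps[OF this lin_h h_self_adjoint h_psd]
    obtain N :: nat and w' where w': "\<And>u. h u = (\<Sum>p<N. (w' p \<bullet> u) *\<^sub>R w' p)"
      by blast
    have "g u = (\<Sum>p<Suc N. ((w'(N := w)) p \<bullet> u) *\<^sub>R (w'(N := w)) p)" for u
    proof -
      have "g u = h u + (w \<bullet> u) *\<^sub>R w" by (simp add: h_def)
      then show ?thesis by (simp add: w')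
    qed
    then show ?thesis by blast
  qed
qed

text \<open>
  The double sum is the tensor product of the two forms. Expanding \<open>g\<close> into rank-one terms turns it
  into a sum, over the vectors \<open>w\<close> of the expansion, of the form of \<open>Z\<close> at the scalar families
  \<open>w \<bullet> y\<^sub>i\<close>.
\<close>

lemma tensor_nonpos:
  fixes Z :: "real ^ 'm ^ 'm" and g :: "'a::euclidean_space \<Rightarrow> 'a" and y :: "'m::finite \<Rightarrow> 'a"
  assumes Z: "nonpos_on Z V" and y: "\<And>w. (\<chi> i. w \<bullet> y i) \<in> V"
    and "linear g" "\<And>u v. u \<bullet> g v = g u \<bullet> v" "\<And>v. 0 \<le> v \<bullet> g v"
  shows "(\<Sum>i\<in>UNIV. \<Sum>j\<in>UNIV. Z $ i $ j * (y i \<bullet> g (y j))) \<le> 0"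
proof -
  obtain N :: nat and w where w: "\<And>v. g v = (\<Sum>p<N. (w p \<bullet> v) *\<^sub>R w p)"
    using psd_sum_of_rank_one[of g] assms(3-5) by blast
  have "(\<Sum>i\<in>UNIV. \<Sum>j\<in>UNIV. Z $ i $ j * (y i \<bullet> g (y j)))
      = (\<Sum>i\<in>UNIV. \<Sum>j\<in>UNIV. \<Sum>p<N. Z $ i $ j * ((w p \<bullet> y j) * (w p \<bullet> y i)))"
    by (simp add: w inner_sum_right sum_distrib_left inner_commute)
  also have "\<dots> = (\<Sum>i\<in>UNIV. \<Sum>p<N. \<Sum>j\<in>UNIV. Z $ i $ j * ((w p \<bullet> y j) * (w p \<bullet> y i)))"
    by (intro sum.cong refl sum.swap)
  also have "\<dots> = (\<Sum>p<N. \<Sum>i\<in>UNIV. \<Sum>j\<in>UNIV. Z $ i $ j * ((w p \<bullet> y j) * (w p \<bullet> y i)))"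
    by (rule sum.swap)
  also have "\<dots> = (\<Sum>p<N. (\<chi> i. w p \<bullet> y i) \<bullet> (Z *v (\<chi> i. w p \<bullet> y i)))"
    by (simp add: inner_vec_def matrix_vector_mult_def sum_distrib_left mult_ac)
  also have "\<dots> \<le> 0"
    using Z y by (intro sum_nonpos) (auto simp: nonpos_on_def)
  finally show ?thesis .
qed

lemma inner_sym_part:
  fixes Z :: "real ^ 'm ^ 'm"
  shows "u \<bullet> (sym_part Z *v u) = u \<bullet> (Z *v u)"
proof -
  have "u \<bullet> (transpose Z *v u) = u \<bullet> (Z *v u)"
    by (metis dot_lmul_matrix inner_commute transpose_matrix_vector)
  then show ?thesis
    by (simp add: sym_part_def scaleR_matrix_vector_assoc[symmetric] matrix_vector_mult_add_rdistrib
        inner_add_right)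
qed

lemma positive_definite_diag_mat:
  assumes "positive_definite (diag_mat d)"
  shows "0 < d $ i"
proof -
  have "0 < axis i 1 \<bullet> (diag_mat d *v axis i 1)"
    using assms by (simp add: positive_definite_def axis_eq_0_iff)
  then show ?thesis
    by (simp add: inner_axis' matrix_vector_mul_component diag_mat_def inner_axis)
qed

lemma diag_mat_mult_component: "(diag_mat d ** A) $ i $ j = d $ i * A $ i $ j"
  by (simp add: matrix_matrix_mult_def diag_mat_def if_distrib[where f = "\<lambda>x. x * _"] cong: if_cong)

section \<open>Clusterings and deviations from cluster means\<close>

definition cluster_index :: "nat \<Rightarrow> (nat \<Rightarrow> 'm set) \<Rightarrow> 'm \<Rightarrow> nat" where
  "cluster_index K C i = (THE k. k \<in> {1..K} \<and> i \<in> C k)"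

lemma cluster_index_eqI:
  assumes "is_clustering K C" "k \<in> {1..K}" "i \<in> C k"
  shows "cluster_index K C i = k"
  unfolding cluster_index_def
proof (rule the_equality)
  show "l = k" if "l \<in> {1..K} \<and> i \<in> C l" for l
    using that assms unfolding is_clustering_def disjoint_family_on_def by blast
qed (use assms in blast)

lemma cluster_index_mem:
  assumes "is_clustering K C"
  shows "cluster_index K C i \<in> {1..K}" "i \<in> C (cluster_index K C i)"
proof -
  obtain k where "k \<in> {1..K}" "i \<in> C k"
    using assms unfolding is_clustering_def by blast
  with cluster_index_eqI[OF assms this]
  show "cluster_index K C i \<in> {1..K}" "i \<in> C (cluster_index K C i)" by simp_all
qed

lemma sum_by_clusters:
  fixes h :: "'m::finite \<Rightarrow> 'a::comm_monoid_add"
  assumes "is_clustering K C"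
  shows "(\<Sum>i\<in>UNIV. h i) = (\<Sum>k\<in>{1..K}. \<Sum>i\<in>C k. h i)"
  using assms sum.UNION_disjoint[of "{1..K}" C h]
  by (simp add: is_clustering_def disjoint_family_on_def)

definition cluster_mean ::
    "(nat \<Rightarrow> 'm set) \<Rightarrow> real ^ 'm \<Rightarrow> 'a::real_vector ^ 'm \<Rightarrow> nat \<Rightarrow> 'a" where
  "cluster_mean C d X k = (1 / (\<Sum>i\<in>C k. d $ i)) *\<^sub>R (\<Sum>i\<in>C k. d $ i *\<^sub>R X $ i)"

definition deviation ::
    "nat \<Rightarrow> (nat \<Rightarrow> 'm set) \<Rightarrow> real ^ 'm \<Rightarrow> 'a::real_vector ^ 'm \<Rightarrow> 'm \<Rightarrow> 'a" where
  "deviation K C d X i = X $ i - cluster_mean C d X (cluster_index K C i)"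

lemma sum_deviation_cluster:
  fixes X :: "'a::real_vector ^ 'm::finite"
  assumes "is_clustering K C" "\<And>i. 0 < d $ i" "k \<in> {1..K}"
  shows "(\<Sum>i\<in>C k. d $ i *\<^sub>R deviation K C d X i) = 0"
proof (cases "C k = {}")
  case False
  then have "(\<Sum>i\<in>C k. d $ i) > 0"
    by (intro sum_pos) (auto simp: assms)
  moreover have "(\<Sum>i\<in>C k. d $ i *\<^sub>R deviation K C d X i)
      = (\<Sum>i\<in>C k. d $ i *\<^sub>R (X $ i - cluster_mean C d X k))"
    using assms by (intro sum.cong refl) (auto simp: deviation_def cluster_index_eqI)
  ultimately show ?thesis
    by (simp add: scaleR_diff_right sum_subtractf scaleR_sum_left[symmetric] cluster_mean_def
        sum_divide_distrib[symmetric])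
qed simp

lemma deviation_orthogonal_to_cluster_constants:
  fixes X :: "'a::real_inner ^ 'm::finite"
  assumes "is_clustering K C" "\<And>i. 0 < d $ i"
  shows "(\<Sum>i\<in>UNIV. d $ i * (deviation K C d X i \<bullet> z (cluster_index K C i))) = 0"
proof -
  have "(\<Sum>i\<in>C k. d $ i * (deviation K C d X i \<bullet> z (cluster_index K C i))) = 0"
    if k: "k \<in> {1..K}" for k
  proof -
    have "(\<Sum>i\<in>C k. d $ i * (deviation K C d X i \<bullet> z (cluster_index K C i)))
        = (\<Sum>i\<in>C k. d $ i *\<^sub>R deviation K C d X i) \<bullet> z k"
      unfolding inner_sum_left
      using assms k by (intro sum.cong refl) (auto simp: cluster_index_eqI)
    then show ?thesis
      using sum_deviation_cluster[OF assms k, of X] by simp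
  qed
  then show ?thesis
    by (simp add: sum_by_clusters[OF assms(1)])
qed

lemma deviation_components_transverse:
  fixes X :: "'a::real_inner ^ 'm::finite"
  assumes "is_clustering K C" "\<And>i. 0 < d $ i"
  shows "(\<chi> i. w \<bullet> deviation K C d X i) \<in> transverse_space K C d"
proof -
  have "(\<Sum>i\<in>C k. d $ i * (w \<bullet> deviation K C d X i)) = 0" if "k \<in> {1..K}" for k
  proof -
    have "(\<Sum>i\<in>C k. d $ i * (w \<bullet> deviation K C d X i))
        = w \<bullet> (\<Sum>i\<in>C k. d $ i *\<^sub>R deviation K C d X i)"
      by (simp add: inner_sum_right)
    then show ?thesis
      using sum_deviation_cluster[OF assms that, of X] by simp
  qed
  then show ?thesis
    by (simp add: transverse_space_def)
qed

section \<open>Row sums of the weighted Laplacian\<close>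

text \<open>
  The weights average over the neighbours of \<open>i\<close> in one cluster, so they add up to one as soon as
  there is such a neighbour; how many there are does not matter.
\<close>

lemma sum_coupling_weight:
  fixes C :: "nat \<Rightarrow> 'm::finite set"
  assumes cl: "is_clustering K C" and k: "k \<in> {1..K}"
  shows "(\<Sum>j\<in>C k. coupling_weight E K C i j) = (if cluster_nbhd E C k i = {} then 0 else 1)"
proof -
  have the_k: "(THE k'. k' \<in> {1..K} \<and> j \<in> cluster_nbhd E C k' i) = k"
    if "j \<in> cluster_nbhd E C k i" for j
  proof (rule the_equality)
    show "l = k" if "l \<in> {1..K} \<and> j \<in> cluster_nbhd E C l i" for l
      using that k cl \<open>j \<in> cluster_nbhd E C k i\<close>
      by (metis IntD2 cluster_nbhd_def cluster_index_eqI)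
  qed (use that k in blast)
  have weight: "coupling_weight E K C i j =
      (if j \<in> cluster_nbhd E C k i then 1 / real (card (cluster_nbhd E C k i)) else 0)"
    if j: "j \<in> C k" for j
  proof (cases "j \<in> cluster_nbhd E C k i")
    case True
    then show ?thesis
      unfolding coupling_weight_def the_k[OF True] using k by auto
  next
    case False
    then have "(i, j) \<notin> E"
      using j by (simp add: cluster_nbhd_def nbhd_def)
    then show ?thesis
      by (simp add: coupling_weight_def cluster_nbhd_def nbhd_def)
  qed
  have "(\<Sum>j\<in>C k. coupling_weight E K C i j)
      = (\<Sum>j\<in>C k. if j \<in> cluster_nbhd E C k i then 1 / real (card (cluster_nbhd E C k i)) else 0)"
    by (intro sum.cong refl weight)
  also have "\<dots> = (\<Sum>j\<in>C k \<inter> cluster_nbhd E C k i. 1 / real (card (cluster_nbhd E C k i)))"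
    by (rule sum.inter_restrict[symmetric]) simp
  also have "C k \<inter> cluster_nbhd E C k i = cluster_nbhd E C k i"
    by (auto simp: cluster_nbhd_def)
  finally show ?thesis
    by (simp add: card_gt_0_iff)
qed

lemma sum_weighted_laplacian_row:
  fixes E :: "('m::finite \<times> 'm) set"
  shows "(\<Sum>j\<in>UNIV. weighted_laplacian E K C $ i $ j) = 0"
proof -
  have "(\<Sum>j\<in>UNIV. weighted_laplacian E K C $ i $ j)
      = weighted_laplacian E K C $ i $ i + (\<Sum>j\<in>UNIV - {i}. weighted_laplacian E K C $ i $ j)"
    by (simp add: sum.remove[of UNIV i])
  also have "(\<Sum>j\<in>UNIV - {i}. weighted_laplacian E K C $ i $ j)
      = (\<Sum>j\<in>UNIV - {i}. coupling_weight E K C i j)"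
    by (intro sum.cong) (auto simp: weighted_laplacian_def)
  finally show ?thesis
    by (simp add: weighted_laplacian_def)
qed

text \<open>
  For a foreign cluster the row sum is zero or one according to whether there is a link, which is
  the same for all vertices of one cluster by hypothesis. The row sum over the own cluster is then
  fixed as well, since whole rows sum to zero.
\<close>

lemma laplacian_cluster_row_sum:
  fixes E :: "('m::finite \<times> 'm) set"
  assumes cl: "is_clustering K C" and coupling: "common_intercluster_coupling E K C"
    and k: "k \<in> {1..K}" "i \<in> C k" "i' \<in> C k" and l: "l \<in> {1..K}"
  shows "(\<Sum>j\<in>C l. weighted_laplacian E K C $ i $ j) = (\<Sum>j\<in>C l. weighted_laplacian E K C $ i' $ j)"
proof -
  have foreign: "(\<Sum>j\<in>C l. weighted_laplacian E K C $ i $ j)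
      = (\<Sum>j\<in>C l. weighted_laplacian E K C $ i' $ j)" if l: "l \<in> {1..K}" "l \<noteq> k" for l
  proof -
    have row: "(\<Sum>j\<in>C l. weighted_laplacian E K C $ a $ j)
        = (if cluster_nbhd E C l a = {} then 0 else 1)" if a: "a \<in> C k" for a
    proof -
      have "a \<notin> C l"
        using cluster_index_eqI[OF cl k(1) a] cluster_index_eqI[OF cl l(1)] l(2) by metis
      then have "(\<Sum>j\<in>C l. weighted_laplacian E K C $ a $ j) = (\<Sum>j\<in>C l. coupling_weight E K C a j)"
        by (intro sum.cong) (auto simp: weighted_laplacian_def)
      then show ?thesis
        using sum_coupling_weight[OF cl l(1)] by simp
    qed
    have "linked_clusters E K C k i = linked_clusters E K C k i'"
      using coupling k unfolding common_intercluster_coupling_def by blast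
    then have "cluster_nbhd E C l i = {} \<longleftrightarrow> cluster_nbhd E C l i' = {}"
      using l unfolding linked_clusters_def by blast
    then show ?thesis
      using k by (simp add: row)
  qed
  show ?thesis
  proof (cases "l = k")
    case True
    have own: "(\<Sum>j\<in>C k. weighted_laplacian E K C $ a $ j)
        = - (\<Sum>l\<in>{1..K} - {k}. \<Sum>j\<in>C l. weighted_laplacian E K C $ a $ j)" for a
      using sum_weighted_laplacian_row[of E K C a] k(1)
        sum.remove[of "{1..K}" k "\<lambda>l. \<Sum>j\<in>C l. weighted_laplacian E K C $ a $ j"]
      by (simp add: sum_by_clusters[OF cl] del: One_nat_def)
    have "(\<Sum>l\<in>{1..K} - {k}. \<Sum>j\<in>C l. weighted_laplacian E K C $ i $ j)
        = (\<Sum>l\<in>{1..K} - {k}. \<Sum>j\<in>C l. weighted_laplacian E K C $ i' $ j)"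
      by (intro sum.cong refl foreign) auto
    then show ?thesis
      by (simp only: True own)
  next
    case False
    then show ?thesis using foreign[OF l] by blast
  qed
qed

text \<open>
  On a family that is constant on clusters, the Laplacian acts through its row sums over clusters
  only. So the coupling force exerted by the cluster means depends on nothing but the cluster of the
  vertex on which it acts.
\<close>

lemma laplacian_preserves_cluster_constancy:
  fixes E :: "('m::finite \<times> 'm) set" and z :: "nat \<Rightarrow> 'a::real_vector"
  assumes cl: "is_clustering K C" and coupling: "common_intercluster_coupling E K C"
  obtains \<rho> :: "nat \<Rightarrow> 'a" where
    "\<And>i. (\<Sum>j\<in>UNIV. weighted_laplacian E K C $ i $ j *\<^sub>R z (cluster_index K C j))
      = \<rho> (cluster_index K C i)"
proof -
  define S where "S i = (\<Sum>j\<in>UNIV. weighted_laplacian E K C $ i $ j *\<^sub>R z (cluster_index K C j))" for i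
  have S_eq: "S i = (\<Sum>l\<in>{1..K}. (\<Sum>j\<in>C l. weighted_laplacian E K C $ i $ j) *\<^sub>R z l)" for i
    unfolding S_def sum_by_clusters[OF cl] scaleR_sum_left
    by (intro sum.cong refl) (simp add: cluster_index_eqI[OF cl])
  have S_const: "S i = S i'" if "cluster_index K C i = cluster_index K C i'" for i i'
  proof -
    have "i' \<in> C (cluster_index K C i)"
      using cluster_index_mem(2)[OF cl, of i'] that by simp
    from laplacian_cluster_row_sum[OF cl coupling cluster_index_mem[OF cl, of i] this]
    show ?thesis
      unfolding S_eq by (intro sum.cong[OF refl]) simp
  qed
  have "S i = S (SOME i'. cluster_index K C i' = cluster_index K C i)" for i
    by (rule S_const) (metis (mono_tags, lifting) someI)
  then show thesis
    by (intro that[of "\<lambda>k. S (SOME i'. cluster_index K C i' = k)"]) (simp add: S_def)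
qed

section \<open>Dissipation of energy\<close>

definition coupled_field ::
    "('m::finite \<times> 'm) set \<Rightarrow> nat \<Rightarrow> (nat \<Rightarrow> 'm set) \<Rightarrow> (nat \<Rightarrow> real ^ 'n \<Rightarrow> real ^ 'n) \<Rightarrow>
     real ^ 'n ^ 'n \<Rightarrow> real \<Rightarrow> real ^ 'n ^ 'm \<Rightarrow> real ^ 'n ^ 'm" where
  "coupled_field E K C f \<Gamma> c X = (\<chi> i. f (cluster_index K C i) (X $ i)
     + c *\<^sub>R (\<Sum>j\<in>UNIV. weighted_laplacian E K C $ i $ j *\<^sub>R (\<Gamma> *v (X $ j))))"

text \<open>
  This is the pointwise inequality behind \<open>V' \<le> - 2 * \<delta> * V\<close>. In the field at vertex \<open>i\<close>, the terms
  \<open>f (mean)\<close> and \<open>L \<Gamma> (mean)\<close> depend only on the cluster of \<open>i\<close> and are invisible to the deviations;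
  the term \<open>\<alpha> \<Gamma> y\<^sub>i\<close> is moved from the individual dynamics to the coupling.
\<close>

lemma energy_dissipation:
  fixes E :: "('m::finite \<times> 'm) set" and X :: "real ^ 'n ^ 'm"
  assumes cl: "is_clustering K C" and coupling: "common_intercluster_coupling E K C"
    and d: "\<And>i. 0 < d $ i"
    and \<Gamma>: "transpose \<Gamma> = \<Gamma>" "nonneg_definite \<Gamma>"
    and decr: "\<And>k \<xi> \<zeta>. k \<in> {1..K} \<Longrightarrow>
        (\<xi> - \<zeta>) \<bullet> (f k \<xi> - f k \<zeta> - \<alpha> *\<^sub>R (\<Gamma> *v (\<xi> - \<zeta>))) \<le> - \<delta> * ((\<xi> - \<zeta>) \<bullet> (\<xi> - \<zeta>))"
    and nonpos: "nonpos_on (diag_mat d ** (c *\<^sub>R weighted_laplacian E K C + \<alpha> *\<^sub>R mat 1))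
        (transverse_space K C d)"
  shows "(\<Sum>i\<in>UNIV. d $ i * (deviation K C d X i \<bullet> coupled_field E K C f \<Gamma> c X $ i))
    \<le> - \<delta> * (\<Sum>i\<in>UNIV. d $ i * (deviation K C d X i \<bullet> deviation K C d X i))"
proof -
  define y where "y = deviation K C d X"
  define \<kappa> where "\<kappa> = cluster_index K C"
  define \<mu> where "\<mu> = cluster_mean C d X"
  define L where "L = weighted_laplacian E K C"
  have X: "X $ i = y i + \<mu> (\<kappa> i)" for i
    by (simp add: y_def \<mu>_def \<kappa>_def deviation_def)
  have \<kappa>: "\<kappa> i \<in> {1..K}" for i
    unfolding \<kappa>_def by (rule cluster_index_mem[OF cl])
  obtain \<rho> :: "nat \<Rightarrow> real ^ 'n" where
    \<rho>: "\<And>i. (\<Sum>j\<in>UNIV. L $ i $ j *\<^sub>R (\<Gamma> *v \<mu> (\<kappa> j))) = \<rho> (\<kappa> i)"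
    using laplacian_preserves_cluster_constancy[OF cl coupling, of "\<lambda>k. \<Gamma> *v \<mu> k"]
    unfolding L_def \<kappa>_def by blast
  define Z where "Z = diag_mat d ** (c *\<^sub>R L + \<alpha> *\<^sub>R mat 1)"
  define z where "z k = f k (\<mu> k) + c *\<^sub>R \<rho> k" for k
  have field: "coupled_field E K C f \<Gamma> c X $ i
      = (f (\<kappa> i) (X $ i) - f (\<kappa> i) (\<mu> (\<kappa> i)) - \<alpha> *\<^sub>R (\<Gamma> *v y i))
        + (c *\<^sub>R (\<Sum>j\<in>UNIV. L $ i $ j *\<^sub>R (\<Gamma> *v y j)) + \<alpha> *\<^sub>R (\<Gamma> *v y i)) + z (\<kappa> i)" for i
  proof -
    have "(\<Sum>j\<in>UNIV. L $ i $ j *\<^sub>R (\<Gamma> *v X $ j))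
        = (\<Sum>j\<in>UNIV. L $ i $ j *\<^sub>R (\<Gamma> *v y j)) + \<rho> (\<kappa> i)"
      by (simp add: X matrix_vector_right_distrib scaleR_add_right sum.distrib \<rho>)
    then show ?thesis
      by (simp add: coupled_field_def L_def[symmetric] \<kappa>_def[symmetric] z_def scaleR_add_right)
  qed
  have Z_row: "(\<Sum>j\<in>UNIV. Z $ i $ j * (y i \<bullet> (\<Gamma> *v y j)))
      = d $ i * (y i \<bullet> (c *\<^sub>R (\<Sum>j\<in>UNIV. L $ i $ j *\<^sub>R (\<Gamma> *v y j)) + \<alpha> *\<^sub>R (\<Gamma> *v y i)))" for i
  proof -
    have "(\<Sum>j\<in>UNIV. Z $ i $ j * (y i \<bullet> (\<Gamma> *v y j)))
        = (\<Sum>j\<in>UNIV. d $ i * (c * (L $ i $ j * (y i \<bullet> (\<Gamma> *v y j))))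
            + (if i = j then d $ i * (\<alpha> * (y i \<bullet> (\<Gamma> *v y j))) else 0))"
      by (intro sum.cong refl) (simp add: Z_def diag_mat_mult_component mat_def algebra_simps)
    also have "\<dots> = d $ i * (c * (\<Sum>j\<in>UNIV. L $ i $ j * (y i \<bullet> (\<Gamma> *v y j))))
        + d $ i * (\<alpha> * (y i \<bullet> (\<Gamma> *v y i)))"
      by (simp add: sum.distrib sum_distrib_left)
    finally show ?thesis
      by (simp add: inner_add_right inner_sum_right distrib_left)
  qed
  have individual: "(\<Sum>i\<in>UNIV. d $ i *
        (y i \<bullet> (f (\<kappa> i) (X $ i) - f (\<kappa> i) (\<mu> (\<kappa> i)) - \<alpha> *\<^sub>R (\<Gamma> *v y i))))
      \<le> - \<delta> * (\<Sum>i\<in>UNIV. d $ i * (y i \<bullet> y i))"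
  proof -
    have "d $ i * (y i \<bullet> (f (\<kappa> i) (X $ i) - f (\<kappa> i) (\<mu> (\<kappa> i)) - \<alpha> *\<^sub>R (\<Gamma> *v y i)))
        \<le> d $ i * (- \<delta> * (y i \<bullet> y i))" for i
      using decr[OF \<kappa>, of "X $ i" "\<mu> (\<kappa> i)" i] less_imp_le[OF d[of i]]
      by (intro mult_left_mono) (auto simp: X)
    then show ?thesis
      unfolding sum_distrib_left by (intro sum_mono) (simp add: mult.left_commute)
  qed
  have coupled: "(\<Sum>i\<in>UNIV. \<Sum>j\<in>UNIV. Z $ i $ j * (y i \<bullet> (\<Gamma> *v y j))) \<le> 0"
  proof (rule tensor_nonpos)
    show "nonpos_on Z (transverse_space K C d)"
      using nonpos by (simp add: Z_def L_def)
    show "(\<chi> i. w \<bullet> y i) \<in> transverse_space K C d" for w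
      unfolding y_def by (rule deviation_components_transverse[OF cl d])
    show "u \<bullet> (\<Gamma> *v v) = (\<Gamma> *v u) \<bullet> v" for u v
      using \<Gamma>(1) by (metis dot_lmul_matrix transpose_matrix_vector)
  qed (use \<Gamma>(2) in \<open>auto simp: nonneg_definite_def\<close>)
  have constants: "(\<Sum>i\<in>UNIV. d $ i * (y i \<bullet> z (\<kappa> i))) = 0"
    unfolding y_def \<kappa>_def by (rule deviation_orthogonal_to_cluster_constants[OF cl d])
  have "(\<Sum>i\<in>UNIV. d $ i * (y i \<bullet> coupled_field E K C f \<Gamma> c X $ i))
      = (\<Sum>i\<in>UNIV. d $ i *
          (y i \<bullet> (f (\<kappa> i) (X $ i) - f (\<kappa> i) (\<mu> (\<kappa> i)) - \<alpha> *\<^sub>R (\<Gamma> *v y i))))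
        + (\<Sum>i\<in>UNIV. \<Sum>j\<in>UNIV. Z $ i $ j * (y i \<bullet> (\<Gamma> *v y j)))
        + (\<Sum>i\<in>UNIV. d $ i * (y i \<bullet> z (\<kappa> i)))"
    unfolding Z_row sum.distrib[symmetric]
    by (intro sum.cong refl) (simp only: field inner_add_right distrib_left)
  then show ?thesis
    using individual coupled constants unfolding y_def by linarith
qed

section \<open>Convergence\<close>

text \<open>Multiplied by \<open>exp (r * t)\<close>, such a function is nonincreasing.\<close>

lemma exponential_decay:
  fixes V V' :: "real \<Rightarrow> real"
  assumes deriv: "\<And>t. 0 \<le> t \<Longrightarrow> (V has_real_derivative V' t) (at t within {0..})"
    and le: "\<And>t. 0 \<le> t \<Longrightarrow> V' t \<le> - r * V t"
    and nonneg: "\<And>t. 0 \<le> V t" and "r > 0"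
  shows "(V \<longlongrightarrow> 0) at_top"
proof -
  define W where "W t = exp (r * t) * V t" for t
  have W_deriv: "(W has_real_derivative exp (r * t) * (V' t + r * V t)) (at t within {0..})"
    if "0 \<le> t" for t
    unfolding W_def using deriv[OF that]
    by (auto intro!: derivative_eq_intros simp: algebra_simps)
  have W_le: "W t \<le> W 0" if "0 \<le> t" for t
  proof (rule DERIV_nonpos_imp_decreasing_open[OF that])
    fix s :: real assume s: "0 < s" "s < t"
    have "at s within {0..} = at s"
      using s by (intro at_within_interior) simp
    moreover have "exp (r * s) * (V' s + r * V s) \<le> 0"
      using le[of s] s by (intro mult_nonneg_nonpos) auto
    ultimately show "\<exists>l. (W has_real_derivative l) (at s) \<and> l \<le> 0"
      using W_deriv[of s] s by auto
  next
    show "continuous_on {0..t} W"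
      by (rule continuous_on_subset[of "{0..}"], rule DERIV_continuous_on[OF W_deriv]) auto
  qed
  have "V t \<le> V 0 * exp (- r * t)" if "0 \<le> t" for t
    using W_le[OF that]
    by (simp add: W_def exp_minus divide_inverse[symmetric] pos_le_divide_eq mult.commute)
  then have "\<forall>\<^sub>F t in at_top. V t \<le> V 0 * exp (- r * t)"
    by (intro eventually_mono[OF eventually_ge_at_top[of 0]]) auto
  moreover have "((\<lambda>t. V 0 * exp (- r * t)) \<longlongrightarrow> 0) at_top"
  proof -
    have "filterlim (\<lambda>t. - r * t) at_bot at_top"
      using \<open>r > 0\<close>
      by (intro filterlim_tendsto_neg_mult_at_bot[OF tendsto_const] filterlim_ident) simp
    then have "((\<lambda>t. exp (- r * t)) \<longlongrightarrow> 0) at_top"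
      by (rule filterlim_compose[OF exp_at_bot])
    then show ?thesis
      by (rule tendsto_mult_right_zero)
  qed
  ultimately show ?thesis
    using nonneg by (intro tendsto_sandwich[of "\<lambda>_. 0" V at_top]) auto
qed

lemma has_vector_derivative_deviation:
  fixes x :: "real \<Rightarrow> 'a::real_normed_vector ^ 'm::finite"
  assumes "\<And>i. ((\<lambda>s. x s $ i) has_vector_derivative x' $ i) F"
  shows "((\<lambda>s. deviation K C d (x s) i) has_vector_derivative deviation K C d x' i) F"
  unfolding deviation_def cluster_mean_def has_vector_derivative_def
  using assms[unfolded has_vector_derivative_def]
  by (auto intro!: derivative_eq_intros simp: scaleR_diff_right scaleR_sum_right ac_simps)

text \<open>
  The derivative of \<open>y\<^sub>i\<close> is the deviation of the derivative of \<open>x\<close>; it may be replaced by the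
  derivative of \<open>x\<^sub>i\<close> itself because the mean that is left out depends only on the cluster.
\<close>

lemma energy_derivative:
  fixes x :: "real \<Rightarrow> 'a::real_inner ^ 'm::finite"
  assumes cl: "is_clustering K C" and d: "\<And>i. 0 < d $ i"
    and x': "\<And>i. ((\<lambda>s. x s $ i) has_vector_derivative x' $ i) (at t within S)"
  shows "((\<lambda>s. \<Sum>i\<in>UNIV. d $ i * (deviation K C d (x s) i \<bullet> deviation K C d (x s) i))
    has_real_derivative 2 * (\<Sum>i\<in>UNIV. d $ i * (deviation K C d (x t) i \<bullet> x' $ i))) (at t within S)"
proof -
  let ?y = "\<lambda>s. deviation K C d (x s)"
  have y': "((\<lambda>s. ?y s i) has_derivative (\<lambda>h. h *\<^sub>R deviation K C d x' i)) (at t within S)" for i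
    using has_vector_derivative_deviation[OF x', of K C d i]
    by (simp add: has_vector_derivative_def)
  have "((\<lambda>s. \<Sum>i\<in>UNIV. d $ i * (?y s i \<bullet> ?y s i)) has_derivative
      (\<lambda>h. \<Sum>i\<in>UNIV. d $ i * (?y t i \<bullet> (h *\<^sub>R deviation K C d x' i)
        + (h *\<^sub>R deviation K C d x' i) \<bullet> ?y t i))) (at t within S)"
    by (intro has_derivative_sum has_derivative_mult_right has_derivative_inner y')
  moreover have "(\<lambda>h. \<Sum>i\<in>UNIV. d $ i * (?y t i \<bullet> (h *\<^sub>R deviation K C d x' i)
        + (h *\<^sub>R deviation K C d x' i) \<bullet> ?y t i))
      = (*) (2 * (\<Sum>i\<in>UNIV. d $ i * (?y t i \<bullet> deviation K C d x' i)))"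
    by (rule ext) (simp add: sum_distrib_left sum_distrib_right inner_commute algebra_simps)
  moreover have "(\<Sum>i\<in>UNIV. d $ i * (?y t i \<bullet> deviation K C d x' i))
      = (\<Sum>i\<in>UNIV. d $ i * (?y t i \<bullet> x' $ i))"
    using deviation_orthogonal_to_cluster_constants[OF cl d, of "x t" "cluster_mean C d x'"]
    by (simp add: deviation_def[of K C d x'] inner_diff_right right_diff_distrib sum_subtractf)
  ultimately show ?thesis
    by (simp add: has_field_derivative_def)
qed

lemma uniform_decreasing_condition:
  fixes f :: "nat \<Rightarrow> real ^ 'n \<Rightarrow> real ^ 'n"
  assumes "\<And>k. k \<in> {1..K} \<Longrightarrow> decreasing_condition (f k) \<alpha> \<Gamma>"
  obtains \<delta> where "\<delta> > 0" "\<And>k \<xi> \<zeta>. k \<in> {1..K} \<Longrightarrow>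
    (\<xi> - \<zeta>) \<bullet> (f k \<xi> - f k \<zeta> - \<alpha> *\<^sub>R (\<Gamma> *v (\<xi> - \<zeta>))) \<le> - \<delta> * ((\<xi> - \<zeta>) \<bullet> (\<xi> - \<zeta>))"
proof -
  obtain \<delta> where \<delta>: "\<And>k. k \<in> {1..K} \<Longrightarrow> \<delta> k > 0"
    "\<And>k \<xi> \<zeta>. k \<in> {1..K} \<Longrightarrow>
      (\<xi> - \<zeta>) \<bullet> (f k \<xi> - f k \<zeta> - \<alpha> *\<^sub>R (\<Gamma> *v (\<xi> - \<zeta>))) \<le> - \<delta> k * ((\<xi> - \<zeta>) \<bullet> (\<xi> - \<zeta>))"
    using assms unfolding decreasing_condition_def by metis
  \<comment> \<open>The element \<open>1\<close> only makes the set nonempty when there are no indices.\<close>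
  define \<epsilon> where "\<epsilon> = Min (insert 1 (\<delta> ` {1..K}))"
  have "\<epsilon> > 0"
    using \<delta>(1) by (auto simp: \<epsilon>_def)
  moreover have "(\<xi> - \<zeta>) \<bullet> (f k \<xi> - f k \<zeta> - \<alpha> *\<^sub>R (\<Gamma> *v (\<xi> - \<zeta>))) \<le> - \<epsilon> * ((\<xi> - \<zeta>) \<bullet> (\<xi> - \<zeta>))"
    if k: "k \<in> {1..K}" for k \<xi> \<zeta>
  proof -
    have "\<epsilon> \<le> \<delta> k"
      unfolding \<epsilon>_def using k by (intro Min_le) auto
    then have "- \<delta> k * ((\<xi> - \<zeta>) \<bullet> (\<xi> - \<zeta>)) \<le> - \<epsilon> * ((\<xi> - \<zeta>) \<bullet> (\<xi> - \<zeta>))"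
      by (intro mult_right_mono) auto
    then show ?thesis using \<delta>(2)[OF k] by (rule order_trans[rotated])
  qed
  ultimately show thesis by (rule that)
qed

theorem theorem1:
  fixes E :: "('m::finite \<times> 'm) set"
    and K :: nat
    and C :: "nat \<Rightarrow> 'm set"
    and f :: "nat \<Rightarrow> real ^ 'n \<Rightarrow> real ^ 'n"
    and \<Gamma> :: "real ^ 'n ^ 'n"
    and c \<alpha> :: real
  assumes "irrefl E" and "sym E"
    and "is_clustering K C"
    and "\<And>k. k \<in> {1..K} \<Longrightarrow> continuous_on UNIV (f k)"
    and "c > 0"
    and "solutions_global_and_bounded E K C f \<Gamma> c"
    and "common_intercluster_coupling E K C"
    and "transpose \<Gamma> = \<Gamma>" and "nonneg_definite \<Gamma>"
    and "\<And>k. k \<in> {1..K} \<Longrightarrow> decreasing_condition (f k) \<alpha> \<Gamma>"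
    and "\<exists>d. positive_definite (diag_mat d) \<and>
           nonpos_on (sym_part (diag_mat d ** (c *\<^sub>R weighted_laplacian E K C + \<alpha> *\<^sub>R mat 1)))
             (transverse_space K C d)"
  shows "cluster_synchronizes E K C f \<Gamma> c"
proof -
  note cl = assms(3) and coupling = assms(7)
  obtain d where "positive_definite (diag_mat d)"
    and "nonpos_on (sym_part (diag_mat d ** (c *\<^sub>R weighted_laplacian E K C + \<alpha> *\<^sub>R mat 1)))
      (transverse_space K C d)"
    using assms(11) by blast
  then have d: "0 < d $ i"
    and nonpos: "nonpos_on (diag_mat d ** (c *\<^sub>R weighted_laplacian E K C + \<alpha> *\<^sub>R mat 1))
      (transverse_space K C d)" for i
    by (simp_all add: positive_definite_diag_mat nonpos_on_def inner_sym_part)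
  obtain \<delta> where \<delta>: "\<delta> > 0" and decr: "\<And>k \<xi> \<zeta>. k \<in> {1..K} \<Longrightarrow>
      (\<xi> - \<zeta>) \<bullet> (f k \<xi> - f k \<zeta> - \<alpha> *\<^sub>R (\<Gamma> *v (\<xi> - \<zeta>))) \<le> - \<delta> * ((\<xi> - \<zeta>) \<bullet> (\<xi> - \<zeta>))"
    using uniform_decreasing_condition[of K f \<alpha> \<Gamma>] assms(10) by blast
  show ?thesis
    unfolding cluster_synchronizes_def
  proof (intro allI impI ballI)
    fix x k i j
    assume sol: "coupled_solution E K C f \<Gamma> c x"
      and k: "k \<in> {1..K}" "i \<in> C k" "j \<in> C k"
    define y where "y t = deviation K C d (x t)" for t
    define V where "V t = (\<Sum>i\<in>UNIV. d $ i * (y t i \<bullet> y t i))" for t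
    have "((\<lambda>s. x s $ a) has_vector_derivative coupled_field E K C f \<Gamma> c (x t) $ a)
        (at t within {0..})" if "0 \<le> t" for t a
      using sol that cluster_index_mem[OF cl, of a]
      unfolding coupled_solution_def coupled_field_def by simp
    then have V_deriv: "(V has_real_derivative
        2 * (\<Sum>i\<in>UNIV. d $ i * (y t i \<bullet> coupled_field E K C f \<Gamma> c (x t) $ i))) (at t within {0..})"
      if "0 \<le> t" for t
      unfolding V_def y_def using that by (intro energy_derivative[OF cl d]) auto
    have V_le: "2 * (\<Sum>i\<in>UNIV. d $ i * (y t i \<bullet> coupled_field E K C f \<Gamma> c (x t) $ i))
        \<le> - (2 * \<delta>) * V t" for t
      using energy_dissipation[OF cl coupling d assms(8,9) decr nonpos, where X = "x t"]
      by (simp add: V_def y_def)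
    have V_nonneg: "0 \<le> V t" for t
      unfolding V_def using d by (intro sum_nonneg mult_nonneg_nonneg) (auto intro: less_imp_le)
    have V_lim: "(V \<longlongrightarrow> 0) at_top"
      using exponential_decay[OF V_deriv V_le V_nonneg] \<delta> by simp
    have y_lim: "((\<lambda>t. y t a) \<longlongrightarrow> 0) at_top" for a
    proof -
      have "d $ a * (y t a \<bullet> y t a) \<le> V t" for t
        unfolding V_def using d
        by (intro member_le_sum mult_nonneg_nonneg) (auto intro: less_imp_le)
      then have bound: "(norm (y t a))\<^sup>2 \<le> V t / d $ a" for t
        using d[of a] by (simp add: power2_norm_eq_inner pos_le_divide_eq mult.commute)
      have "((\<lambda>t. V t / d $ a) \<longlongrightarrow> 0) at_top"
        using tendsto_divide[OF V_lim tendsto_const[of "d $ a"]] d[of a] by simp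
      then have "((\<lambda>t. (norm (y t a))\<^sup>2) \<longlongrightarrow> 0) at_top"
        by (rule tendsto_sandwich[OF _ _ tendsto_const, rotated 2]) (simp_all add: bound)
      then have "((\<lambda>t. sqrt ((norm (y t a))\<^sup>2)) \<longlongrightarrow> sqrt 0) at_top"
        by (rule tendsto_real_sqrt)
      then show ?thesis
        by (simp add: tendsto_norm_zero_iff)
    qed
    have "x t $ i - x t $ j = y t i - y t j" for t
      using k cl by (simp add: y_def deviation_def cluster_index_eqI)
    then show "((\<lambda>t. x t $ i - x t $ j) \<longlongrightarrow> 0) at_top"
      using tendsto_diff[OF y_lim[of i] y_lim[of j]] by simp
  qed
qed

end
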